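(* Let $s \ge 2$ and let $\sigma$ be a string of length $n$ over the alphabet $\Sigma = T \cup \bar{T}$ with $|T| = s$. Let $d$ be the optimal edit distance from $\sigma$ to $\mathrm{Dyck}(s)$. Then the algorithm Random-deletion runs in linear time and, with constant probability, outputs a well-balanced string whose edit distance from $\sigma$ is within a factor $4d$ of the optimum, i.e. Random-deletion obtains a $4d$-approximation for edit distance (insertions, deletions, substitutions) to $\mathrm{Dyck}(s)$.
   Context: $T$ is a finite set of open parentheses; each $x \in T$ has a unique congruent (matching) close parenthesis $\bar{x}$, and $\bar{T} = \{\bar{x} : x \in T\}$. $\mathrm{Dyck}(s)$, $s = |T|$, is the language of well-balanced strings over $T \cup \bar{T}$, generated by $S \to SS$, $S \to \varepsilon$, $S \to a S \bar{a}$ for all $a \in T$. The edit distance from $\sigma$ to $\mathrm{Dyck}(s)$ is the minimum number of single-symbol insertions, deletions and substitutions needed to turn $\sigma$ into a string of $\mathrm{Dyck}(s)$. Random-deletion: initialize an empty stack and scan $\sigma$ left to right. If the current symbol is an open parenthesis, push it. If it is a close parenthesis: if the stack is empty, delete the current symbol; if the stack top is the matching open parenthesis, match (pop) them; otherwise delete either the stack top or the current symbol, each with probability $1/2$ independently of everything else. When the scan ends, delete all symbols remaining in the stack. The output is the resulting well-balanced string. *)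

theory Defs
  imports "HOL-Probability.Probability"
begin

text \<open>
  The two alphabets $T$ and $\bar T$ are represented by a set \<open>T\<close> of parenthesis types:
  \<open>Op x\<close> is the open parenthesis of type \<open>x\<close> and \<open>Cl x\<close> its unique congruent close parenthesis.
\<close>

datatype 'a paren = Op 'a | Cl 'a

definition alphabet :: "'a set \<Rightarrow> 'a paren set" where
  "alphabet T = Op ` T \<union> Cl ` T"

inductive_set Dyck :: "'a set \<Rightarrow> 'a paren list set" for T :: "'a set" where
  concat: "u \<in> Dyck T \<Longrightarrow> v \<in> Dyck T \<Longrightarrow> u @ v \<in> Dyck T"
| empty: "[] \<in> Dyck T"
| wrap: "a \<in> T \<Longrightarrow> u \<in> Dyck T \<Longrightarrow> [Op a] @ u @ [Cl a] \<in> Dyck T"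

inductive edit_step :: "'b list \<Rightarrow> 'b list \<Rightarrow> bool" where
  insertion: "edit_step (u @ v) (u @ [x] @ v)"
| deletion: "edit_step (u @ [x] @ v) (u @ v)"
| substitution: "edit_step (u @ [x] @ v) (u @ [y] @ v)"

definition edit_dist :: "'b list \<Rightarrow> 'b list \<Rightarrow> nat" where
  "edit_dist u v = (LEAST k. (edit_step ^^ k) u v)"

definition edit_dist_lang :: "'b list \<Rightarrow> 'b list set \<Rightarrow> nat" where
  "edit_dist_lang u L = (INF v\<in>L. edit_dist u v)"

text \<open>
  Random-deletion is a randomized program that returns its result together with its running time,
  counted in the unit-cost RAM model. The stack holds the open parentheses together with their
  positions in the input, and deletions are recorded by marking input positions in a bit array,
  represented by the set \<open>D\<close> of the marked positions. The elementary operations, of cost 1 each,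
  are: testing for the end of the input, reading the current symbol, advancing to the next symbol,
  testing whether the stack is empty, pushing, popping, comparing the stack top with the current
  symbol, flipping a coin, writing a mark, reading a mark, and writing an output symbol.
\<close>

definition charge :: "nat \<Rightarrow> ('r \<times> nat) pmf \<Rightarrow> ('r \<times> nat) pmf" where
  "charge c p = map_pmf (\<lambda>(r, t). (r, c + t)) p"

fun clear_stack :: "nat set \<Rightarrow> (nat \<times> 'a) list \<Rightarrow> nat set \<times> nat" where
  "clear_stack D [] = (D, 1)"
| "clear_stack D ((j, a) # st) =
    (let (D', t) = clear_stack (insert j D) st
     in (D', 3 + t))" \<comment> \<open>stack test, pop, mark\<close>

text \<open>
  The arguments are the marked positions, the stack (top first), and the unread input, each symbol
  paired with its position. When the stack top is deleted, the close parenthesis stays the current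
  symbol.
\<close>

fun scan :: "nat set \<Rightarrow> (nat \<times> 'a) list \<Rightarrow> (nat \<times> 'a paren) list \<Rightarrow> (nat set \<times> nat) pmf" where
  "scan D st [] =
    charge 1 (return_pmf (clear_stack D st))" \<comment> \<open>end test\<close>
| "scan D st ((i, Op a) # xs) =
    charge 4 (scan D ((i, a) # st) xs)" \<comment> \<open>end test, read, push, advance\<close>
| "scan D [] ((i, Cl b) # xs) =
    charge 5 (scan (insert i D) [] xs)" \<comment> \<open>end test, read, stack test, mark, advance\<close>
| "scan D ((j, a) # st) ((i, Cl b) # xs) =
    (if a = b
     then charge 6 (scan D st xs) \<comment> \<open>end test, read, stack test, compare, pop, advance\<close>
     else do {
       coin \<leftarrow> bernoulli_pmf (1/2);
       if coin
       then charge 7 (scan (insert j D) st ((i, Cl b) # xs))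
         \<comment> \<open>end test, read, stack test, compare, flip, pop, mark\<close>
       else charge 7 (scan (insert i D) ((j, a) # st) xs)
         \<comment> \<open>end test, read, stack test, compare, flip, mark, advance\<close>
     })"

fun emit :: "nat set \<Rightarrow> (nat \<times> 'b) list \<Rightarrow> 'b list \<times> nat" where
  "emit D [] = ([], 1)"
| "emit D ((i, x) # xs) =
    (let (w, t) = emit D xs
     in if i \<in> D then (w, 3 + t) \<comment> \<open>end test, read mark, advance\<close>
        else (x # w, 5 + t))" \<comment> \<open>additionally: read symbol, write it to the output\<close>

text \<open>The initial charge pays for clearing the \<open>length \<sigma>\<close> marks and creating the empty stack.\<close>

definition random_deletion :: "'a paren list \<Rightarrow> ('a paren list \<times> nat) pmf" where
  "random_deletion \<sigma> =
    charge (length \<sigma> + 1) (do {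
      (D, t) \<leftarrow> scan {} [] (List.enumerate 0 \<sigma>);
      charge t (return_pmf (emit D (List.enumerate 0 \<sigma>)))
    })"

end

theory Submission
  imports Defs
begin

text \<open>
  The potential is the number of deletions that balance the stack followed by the unread input;
  it is at most \<open>2 * d\<close> initially, because every edit operation can be simulated by two deletions.
  At a mismatch every optimal solution deletes the stack top or the current symbol, so a fair coin
  decreases the potential with probability at least \<open>1/2\<close> and otherwise raises it by at most one.
  Hence the number of deletions is dominated by the hitting time of 0 of a simple random walk
  started at \<open>2 * d\<close>, which is at most \<open>(2 * d)\<^sup>2\<close> with constant probability.
\<close>

section \<open>Edit distance\<close>

lemma edit_step_Cons: "edit_step u v \<Longrightarrow> edit_step (x # u) (x # v)"
proof (induction rule: edit_step.induct)
  case (insertion u v y)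
  then show ?case using edit_step.insertion[of "x # u" v y] by simp
next
  case (deletion u y v)
  then show ?case using edit_step.deletion[of "x # u" y v] by simp
next
  case (substitution u y v z)
  then show ?case using edit_step.substitution[of "x # u" y v z] by simp
qed

lemma edit_step_delete_hd: "edit_step (x # u) u"
  using edit_step.deletion[of "[]"] by simp

lemma edit_step_insert_hd: "edit_step u (x # u)"
  using edit_step.insertion[of "[]"] by simp

lemma relpowp_edit_step_Cons: "(edit_step ^^ k) u v \<Longrightarrow> (edit_step ^^ k) (x # u) (x # v)"
  by (induction k arbitrary: v) (auto dest: edit_step_Cons)

lemma relpowp_edit_step_total: "\<exists>k. (edit_step ^^ k) u v"
proof -
  have "edit_step\<^sup>*\<^sup>* u []"
    by (induction u) (auto intro: converse_rtranclp_into_rtranclp edit_step_delete_hd)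
  moreover have "edit_step\<^sup>*\<^sup>* [] v"
    by (induction v) (auto intro: rtranclp.rtrancl_into_rtrancl edit_step_insert_hd)
  ultimately show ?thesis by (metis rtranclp_imp_relpowp rtranclp_trans)
qed

lemma relpowp_edit_dist: "(edit_step ^^ edit_dist u v) u v"
  unfolding edit_dist_def using relpowp_edit_step_total by (rule LeastI_ex)

lemma edit_dist_le: "(edit_step ^^ k) u v \<Longrightarrow> edit_dist u v \<le> k"
  unfolding edit_dist_def by (rule Least_le)

lemma edit_dist_map_filter:
  "edit_dist (map f xs) (map f (filter P xs)) \<le> length (filter (\<lambda>x. \<not> P x) xs)"
proof (rule edit_dist_le)
  show "(edit_step ^^ length (filter (\<lambda>x. \<not> P x) xs)) (map f xs) (map f (filter P xs))"
    by (induction xs)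
      (auto intro: relpowp_0_I relpowp_edit_step_Cons relpowp_Suc_I2 edit_step_delete_hd
        simp del: relpowp.simps)
qed

lemma le_add_mult_edit_dist:
  fixes f :: "'b list \<Rightarrow> nat"
  assumes step: "\<And>u v. edit_step u v \<Longrightarrow> f u \<le> f v + c"
  shows "f u \<le> f v + c * edit_dist u v"
proof -
  have "f u \<le> f v + c * k" if "(edit_step ^^ k) u v" for k
    using that
  proof (induction k arbitrary: u)
    case (Suc k)
    then obtain u' where "edit_step u u'" "(edit_step ^^ k) u' v"
      by (meson relpowp_Suc_D2)
    then show ?case using Suc.IH step[of u u'] by fastforce
  qed simp
  then show ?thesis using relpowp_edit_dist .
qed

lemma edit_dist_lang_attained:
  assumes "L \<noteq> {}"
  obtains v where "v \<in> L" "edit_dist_lang u L = edit_dist u v"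
proof -
  have "edit_dist_lang u L \<in> edit_dist u ` L"
    unfolding edit_dist_lang_def using assms by (intro Inf_nat_def1) simp
  then show ?thesis using that by auto
qed

section \<open>Deletion distance\<close>

fun del_dist :: "'a list \<Rightarrow> 'a paren list \<Rightarrow> nat" where
  "del_dist st [] = length st"
| "del_dist st (Op a # xs) = del_dist (a # st) xs"
| "del_dist [] (Cl b # xs) = Suc (del_dist [] xs)"
| "del_dist (a # st) (Cl b # xs) =
    (if a = b then del_dist st xs
     else Suc (min (del_dist st (Cl b # xs)) (del_dist (a # st) xs)))"

lemma del_dist_Cl_near:
  assumes "\<And>a st. \<bar>int (del_dist (a # st) xs) - int (del_dist st xs)\<bar> \<le> 1"
  shows "\<bar>int (del_dist st (Cl b # xs)) - int (del_dist st xs)\<bar> \<le> 1"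
proof (induction st)
  case (Cons a st)
  then show ?case using assms[of a st] by auto
qed simp

lemma del_dist_stack_near:
  "\<bar>int (del_dist (A @ c # B) xs) - int (del_dist (A @ B) xs)\<bar> \<le> 1"
proof (induction xs arbitrary: A c B)
  case (Cons x xs)
  show ?case
  proof (cases x)
    case (Op a)
    then show ?thesis using Cons[of "a # A"] by simp
  next
    case (Cl b)
    note xs_near = Cons
    have Cl_near: "\<bar>int (del_dist B (Cl b # xs)) - int (del_dist B xs)\<bar> \<le> 1"
      by (rule del_dist_Cl_near) (use Cons[of "[]"] in simp)
    have "\<bar>int (del_dist (A @ c # B) (Cl b # xs)) - int (del_dist (A @ B) (Cl b # xs))\<bar> \<le> 1"
    proof (induction A)
      case Nil
      then show ?case using Cl_near Cons.IH[of "[]" c B] by auto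
    next
      case (Cons a A)
      then show ?case
        using xs_near[of A c B] xs_near[of "a # A" c B] by auto
    qed
    then show ?thesis using Cl by simp
  qed
qed simp

lemma del_dist_Cons_near: "\<bar>int (del_dist st (x # xs)) - int (del_dist st xs)\<bar> \<le> 1"
  using del_dist_stack_near[of "[]"] del_dist_Cl_near by (cases x) force+

lemma del_dist_input_near:
  "\<bar>int (del_dist st (u @ x # v)) - int (del_dist st (u @ v))\<bar> \<le> 1"
proof (induction st u rule: del_dist.induct)
  case (1 st)
  then show ?case using del_dist_Cons_near by simp
qed (auto simp: min_def)

lemma del_dist_mismatch_near:
  "\<bar>int (del_dist st (x # xs)) - int (del_dist (a # st) xs)\<bar> \<le> 2"
  using del_dist_Cons_near[of st x xs] del_dist_stack_near[of "[]" a st xs] by simp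

lemma del_dist_edit_step:
  assumes "edit_step u v"
  shows "del_dist st u \<le> del_dist st v + 2"
  using assms
proof cases
  case (insertion u' v' x)
  then show ?thesis using del_dist_input_near[of st u' x v'] by simp
next
  case (deletion u' x v')
  then show ?thesis using del_dist_input_near[of st u' x v'] by simp
next
  case (substitution u' x v' y)
  then show ?thesis
    using del_dist_input_near[of st u' x v'] del_dist_input_near[of st u' y v'] by simp
qed

lemma del_dist_Dyck_append: "u \<in> Dyck T \<Longrightarrow> del_dist st (u @ xs) = del_dist st xs"
  by (induction u arbitrary: st xs rule: Dyck.induct) auto

lemma del_dist_le_edit_dist_lang: "del_dist [] u \<le> 2 * edit_dist_lang u (Dyck T)"
proof -
  obtain v where v: "v \<in> Dyck T" "edit_dist_lang u (Dyck T) = edit_dist u v"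
    using edit_dist_lang_attained Dyck.empty by (metis empty_iff)
  have "del_dist [] u \<le> del_dist [] v + 2 * edit_dist u v"
    using del_dist_edit_step by (rule le_add_mult_edit_dist)
  moreover have "del_dist [] v = 0"
    using del_dist_Dyck_append[OF v(1), of "[]" "[]"] by simp
  ultimately show ?thesis using v(2) by simp
qed

section \<open>Hitting times of the simple random walk\<close>

lemma prob_bind_pmf:
  "measure_pmf.prob (p \<bind> f) A = measure_pmf.expectation p (\<lambda>x. measure_pmf.prob (f x) A)"
  by (simp add: measure_pmf_bind measure_subprob
      measure_pmf.measure_bind[where N = "count_space UNIV"])

primrec absorbed_walk :: "nat \<Rightarrow> nat \<Rightarrow> nat pmf" where
  "absorbed_walk 0 k = return_pmf k"
| "absorbed_walk (Suc m) k =
    (if k = 0 then return_pmf 0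
     else do {
       coin \<leftarrow> bernoulli_pmf (1/2);
       absorbed_walk m (if coin then k - 1 else k + 1)
     })"

definition hit_prob :: "nat \<Rightarrow> nat \<Rightarrow> real" where
  "hit_prob k m = measure_pmf.prob (absorbed_walk m k) {0}"

lemma hit_prob_0_start [simp]: "hit_prob 0 m = 1"
  by (cases m) (simp_all add: hit_prob_def)

lemma hit_prob_0_time [simp]: "hit_prob (Suc k) 0 = 0"
  by (simp add: hit_prob_def)

lemma hit_prob_Suc_Suc [simp]:
  "hit_prob (Suc k) (Suc m) = (hit_prob k m + hit_prob (Suc (Suc k)) m) / 2"
  by (simp add: hit_prob_def prob_bind_pmf)

lemma hit_prob_nonneg: "0 \<le> hit_prob k m"
  by (simp add: hit_prob_def)

lemma hit_prob_le_1: "hit_prob k m \<le> 1"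
  by (simp add: hit_prob_def)

lemma first_step_induct [case_names arrived timeout step]:
  fixes k m :: nat
  assumes "\<And>m. P 0 m" and "\<And>k. P (Suc k) 0"
    and "\<And>k m. P k m \<Longrightarrow> P (Suc (Suc k)) m \<Longrightarrow> P (Suc k) (Suc m)"
  shows "P k m"
proof (induction m arbitrary: k)
  case 0
  show ?case using assms(1,2) by (cases k) auto
next
  case (Suc m)
  then show ?case using assms(1,3) by (cases k) auto
qed

lemma hit_prob_eq_0: "m < k \<Longrightarrow> hit_prob k m = 0"
  by (induction k m rule: first_step_induct) auto

lemma hit_prob_Suc_start_le: "hit_prob (Suc k) m \<le> hit_prob k m"
proof (induction k m rule: first_step_induct)
  case (arrived m)
  show ?case using hit_prob_le_1 by simp
qed simp_all

lemma hit_prob_antimono_start: "k \<le> k' \<Longrightarrow> hit_prob k' m \<le> hit_prob k m"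
  by (rule lift_Suc_antimono_le[of "\<lambda>k. hit_prob k m"]) (rule hit_prob_Suc_start_le)

lemma hit_prob_le_Suc_time: "hit_prob k m \<le> hit_prob k (Suc m)"
proof (induction k m rule: first_step_induct)
  case (timeout k)
  show ?case using hit_prob_nonneg[of "Suc k" "Suc 0"] by simp
next
  case (step k m)
  then show ?case
    unfolding hit_prob_Suc_Suc by (intro divide_right_mono add_mono) auto
qed simp

lemma hit_prob_mono_time: "m \<le> m' \<Longrightarrow> hit_prob k m \<le> hit_prob k m'"
  by (rule lift_Suc_mono_le[of "hit_prob k"]) (rule hit_prob_le_Suc_time)

lemma hit_prob_Suc_min_le:
  assumes "\<bar>int k - int l\<bar> \<le> 2"
  shows "hit_prob (Suc (min k l)) (Suc m) \<le> (hit_prob k m + hit_prob l m) / 2"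
proof -
  have "hit_prob (Suc (Suc (min k l))) m \<le> hit_prob (max k l) m"
    using assms by (intro hit_prob_antimono_start) auto
  moreover have "hit_prob (min k l) m + hit_prob (max k l) m = hit_prob k m + hit_prob l m"
    by (simp add: min_def max_def)
  ultimately show ?thesis by simp
qed

lemma hit_prob_Suc_Suc_le: "hit_prob (Suc k) (Suc m) \<le> hit_prob k m"
  using hit_prob_Suc_min_le[of k k m] by simp

lemma hit_prob_mult_le: "hit_prob k m * hit_prob j n \<le> hit_prob (k + j) (m + n)"
proof (induction k m rule: first_step_induct)
  case (arrived m)
  show ?case using hit_prob_mono_time[of n "m + n" j] by simp
next
  case (timeout k)
  show ?case using hit_prob_nonneg by simp
next
  case (step k m)
  then show ?case by (simp add: field_simps)
qed

lemma hit_prob_power_le: "hit_prob k m ^ r \<le> hit_prob (r * k) (r * m)"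
proof (induction r)
  case (Suc r)
  have "hit_prob k m ^ Suc r \<le> hit_prob k m * hit_prob (r * k) (r * m)"
    using Suc hit_prob_nonneg by (simp add: mult_left_mono)
  also have "\<dots> \<le> hit_prob (Suc r * k) (Suc r * m)"
    using hit_prob_mult_le by simp
  finally show ?case .
qed simp

lemma hit_prob_self_ge: "(1 / 2) ^ k \<le> hit_prob k k"
proof (induction k)
  case (Suc k)
  then show ?case using hit_prob_nonneg[of "Suc (Suc k)" k] by simp
qed simp

text \<open>
  The left-hand side is a martingale. For \<open>m = M\<close> it reads \<open>(1 - k / L) - k * (L - k) / M\<close>, where
  \<open>1 - k / L\<close> is the probability of reaching 0 before \<open>L\<close> and \<open>k * (L - k)\<close> is the expected time to
  reach one of them, so that the last term is Markov's bound on this taking more than \<open>M\<close> steps.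
\<close>

lemma hit_prob_ge_barrier:
  assumes "0 < L" "0 < M" "m \<le> M" "k \<le> L"
  shows "real m / real M - real k / real L - real k * (real L - real k) / real M \<le> hit_prob k m"
  using assms(3,4)
proof (induction k m rule: first_step_induct)
  case (arrived m)
  then show ?case using assms(2) by (simp add: divide_le_eq_1)
next
  case (timeout k)
  have "0 \<le> real (Suc k) * (real L - real (Suc k)) / real M"
    using timeout by (intro divide_nonneg_nonneg mult_nonneg_nonneg) auto
  moreover have "0 \<le> real (Suc k) / real L" by simp
  ultimately show ?case unfolding hit_prob_0_time of_nat_0 div_0 by linarith
next
  case (step k m)
  show ?case
  proof (cases "Suc k = L")
    case True
    have "real (Suc m) / real M \<le> 1" using step.prems by (simp add: divide_le_eq_1)
    then show ?thesis
      unfolding True using hit_prob_nonneg[of L "Suc m"] assms(1) by simp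
  next
    case False
    let ?g = "\<lambda>k m. m / real M - k / real L - k * (real L - k) / real M"
    have "?g (real (Suc k)) (real (Suc m)) =
        (?g (real k) (real m) + ?g (real (Suc (Suc k))) (real m)) / 2"
      using assms(1,2) by (simp add: field_simps)
    also have "\<dots> \<le> hit_prob (Suc k) (Suc m)"
      unfolding hit_prob_Suc_Suc
      by (intro divide_right_mono add_mono step.IH) (use step.prems False in auto)
    finally show ?thesis .
  qed
qed

lemma hit_prob_three_squares_ge: "0 < k \<Longrightarrow> 1 / 6 \<le> hit_prob k (3 * k\<^sup>2)"
  using hit_prob_ge_barrier[of "2 * k" "3 * k\<^sup>2" "3 * k\<^sup>2" k]
  by (simp add: field_simps power2_eq_square)

text \<open>
  Crossing 12 consecutive stretches of length \<open>j\<close>, about \<open>k / 12\<close>, within \<open>3 * j\<^sup>2\<close> steps each takes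
  about \<open>k\<^sup>2 / 4\<close> steps in all, which leaves room for rounding \<open>j\<close> up.
\<close>

lemma hit_prob_square_ge: "(1 / 6) ^ 12 \<le> hit_prob k (k\<^sup>2)"
proof (cases "k \<le> 12")
  case True
  have "(1 / 6) ^ 12 \<le> (1 / 2 :: real) ^ 12"
    by (rule power_mono) auto
  also have "\<dots> \<le> (1 / 2) ^ k"
    using True by (intro power_decreasing) auto
  also have "\<dots> \<le> hit_prob k k" by (rule hit_prob_self_ge)
  also have "\<dots> \<le> hit_prob k (k\<^sup>2)"
    by (rule hit_prob_mono_time) (simp add: power2_eq_square)
  finally show ?thesis .
next
  case False
  define j where "j = (k + 11) div 12"
  have j: "0 < j" "k \<le> 12 * j" "6 * j \<le> k"
    using False by (auto simp: j_def)
  have "(1 / 6) ^ 12 \<le> hit_prob j (3 * j\<^sup>2) ^ 12"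
    using hit_prob_three_squares_ge j(1) by (intro power_mono) auto
  also have "\<dots> \<le> hit_prob (12 * j) (12 * (3 * j\<^sup>2))" by (rule hit_prob_power_le)
  also have "\<dots> \<le> hit_prob k (12 * (3 * j\<^sup>2))" using j(2) by (rule hit_prob_antimono_start)
  also have "12 * (3 * j\<^sup>2) = (6 * j)\<^sup>2" by (simp add: power_mult_distrib)
  also have "hit_prob k ((6 * j)\<^sup>2) \<le> hit_prob k (k\<^sup>2)"
    using j(3) by (intro hit_prob_mono_time power_mono) auto
  finally show ?thesis .
qed

section \<open>Runs of the scan\<close>

lemma fst_clear_stack: "fst (clear_stack D st) = D \<union> fst ` set st"
  by (induction D st rule: clear_stack.induct) (auto simp: case_prod_unfold Let_def)

lemma snd_clear_stack: "snd (clear_stack D st) = 3 * length st + 1"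
  by (induction D st rule: clear_stack.induct) (auto simp: case_prod_unfold Let_def)

lemma clear_stack_eq: "clear_stack D st = (D \<union> fst ` set st, 3 * length st + 1)"
  by (simp add: prod_eq_iff fst_clear_stack snd_clear_stack)

inductive scan_run ::
  "nat set \<Rightarrow> (nat \<times> 'a) list \<Rightarrow> (nat \<times> 'a paren) list \<Rightarrow> nat set \<Rightarrow> nat \<Rightarrow> bool" where
  finish: "scan_run D st [] (D \<union> fst ` set st) (3 * length st + 2)"
| push: "scan_run D ((i, a) # st) xs D' t \<Longrightarrow> scan_run D st ((i, Op a) # xs) D' (4 + t)"
| unmatched: "scan_run (insert i D) [] xs D' t \<Longrightarrow> scan_run D [] ((i, Cl b) # xs) D' (5 + t)"
| match: "scan_run D st xs D' t \<Longrightarrow> scan_run D ((j, a) # st) ((i, Cl a) # xs) D' (6 + t)"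
| pop: "a \<noteq> b \<Longrightarrow> scan_run (insert j D) st ((i, Cl b) # xs) D' t \<Longrightarrow>
    scan_run D ((j, a) # st) ((i, Cl b) # xs) D' (7 + t)"
| skip: "a \<noteq> b \<Longrightarrow> scan_run (insert i D) ((j, a) # st) xs D' t \<Longrightarrow>
    scan_run D ((j, a) # st) ((i, Cl b) # xs) D' (7 + t)"

lemma set_pmf_charge: "(r, t) \<in> set_pmf (charge c p) \<longleftrightarrow> (\<exists>t'. t = c + t' \<and> (r, t') \<in> set_pmf p)"
  by (force simp: charge_def)

lemma scan_run_if_in_set_pmf: "(D', t) \<in> set_pmf (scan D st xs) \<Longrightarrow> scan_run D st xs D' t"
proof (induction D st xs arbitrary: D' t rule: scan.induct)
  case (1 D st)
  then show ?case
    using scan_run.finish[of D st] by (simp add: charge_def clear_stack_eq)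
next
  case (2 D st i a xs)
  then show ?case by (auto simp: set_pmf_charge intro: scan_run.push)
next
  case (3 D i b xs)
  then show ?case by (auto simp: set_pmf_charge intro: scan_run.unmatched)
next
  case (4 D j a st i b xs)
  show ?case
  proof (cases "a = b")
    case True
    then show ?thesis using 4 by (auto simp: set_pmf_charge intro: scan_run.match)
  next
    case False
    then show ?thesis
      using 4 by (auto simp: set_pmf_charge split: if_splits intro: scan_run.pop scan_run.skip)
  qed
qed

text \<open>Each open parenthesis prepays the 7 units for its later removal from the stack.\<close>

lemma scan_run_time: "scan_run D st xs D' t \<Longrightarrow> t \<le> 7 * length st + 14 * length xs + 2"
  by (induction rule: scan_run.induct) auto

lemma scan_run_marks_increase: "scan_run D st xs D' t \<Longrightarrow> D \<subseteq> D'"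
  by (induction rule: scan_run.induct) auto

lemma scan_run_marks_subset:
  "scan_run D st xs D' t \<Longrightarrow> D' \<subseteq> D \<union> fst ` set st \<union> fst ` set xs"
  by (induction rule: scan_run.induct) auto

lemma scan_run_finite_marks: "scan_run D st xs D' t \<Longrightarrow> finite D \<Longrightarrow> finite D'"
  by (induction rule: scan_run.induct) auto

section \<open>The output is balanced\<close>

lemma Dyck_insert: "A @ B \<in> Dyck T \<Longrightarrow> v \<in> Dyck T \<Longrightarrow> A @ v @ B \<in> Dyck T"
proof (induction "A @ B" arbitrary: A B rule: Dyck.induct)
  case (concat x y)
  from concat.hyps(5) consider us where "x = A @ us" "B = us @ y"
    | us where "A = x @ us" "y = us @ B"
    by (auto simp: append_eq_append_conv2)
  then show ?case
  proof cases
    case 1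
    then show ?thesis
      using Dyck.concat[OF concat.hyps(2)[of A us] concat.hyps(3)] concat.prems by simp
  next
    case 2
    then show ?thesis
      using Dyck.concat[OF concat.hyps(1) concat.hyps(4)[of us B]] concat.prems by simp
  qed
next
  case empty
  then show ?case by simp
next
  case (wrap a u)
  have word: "[Op a] @ u @ [Cl a] \<in> Dyck T" using wrap.hyps(1,2) by (rule Dyck.wrap)
  consider "A = []" | "B = []" | A' B' where "A = Op a # A'" "B = B' @ [Cl a]" "u = A' @ B'"
    using wrap.hyps(4) by (cases A; cases B rule: rev_cases) auto
  then show ?case
  proof cases
    case 1
    then show ?thesis using Dyck.concat[OF wrap.prems word] wrap.hyps(4) by simp
  next
    case 2
    then show ?thesis using Dyck.concat[OF word wrap.prems] wrap.hyps(4) by auto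
  next
    case 3
    then show ?thesis
      using Dyck.wrap[OF wrap.hyps(1) wrap.hyps(3)[of A' B']] wrap.prems by simp
  qed
qed

definition unmarked :: "nat set \<Rightarrow> (nat \<times> 'b) list \<Rightarrow> 'b list" where
  "unmarked D xs = map snd (filter (\<lambda>x. fst x \<notin> D) xs)"

lemma unmarked_Nil [simp]: "unmarked D [] = []"
  by (simp add: unmarked_def)

lemma unmarked_Cons [simp]:
  "unmarked D ((i, x) # xs) = (if i \<in> D then unmarked D xs else x # unmarked D xs)"
  by (simp add: unmarked_def)

lemma unmarked_append [simp]: "unmarked D (xs @ ys) = unmarked D xs @ unmarked D ys"
  by (simp add: unmarked_def)

definition pending :: "(nat \<times> 'a) list \<Rightarrow> (nat \<times> 'a paren) list \<Rightarrow> (nat \<times> 'a paren) list" where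
  "pending st xs = rev (map (apsnd Op) st) @ xs"

lemma unmarked_pending_in_Dyck:
  assumes "scan_run D st xs D' t"
    and "distinct (map fst (pending st xs))"
    and "D \<inter> fst ` set (pending st xs) = {}"
    and "snd ` set (pending st xs) \<subseteq> alphabet T"
  shows "unmarked D' (pending st xs) \<in> Dyck T"
  using assms
proof (induction rule: scan_run.induct)
  case (finish D st)
  have "unmarked (D \<union> fst ` set st) (pending st []) = []"
    by (auto simp: unmarked_def pending_def filter_empty_conv)
  then show ?case using Dyck.empty by simp
next
  case (push D i a st xs D' t)
  then show ?case by (simp add: pending_def)
next
  case (unmatched i D xs D' t b)
  have "i \<in> D'" using scan_run_marks_increase[OF unmatched.hyps] by auto
  then show ?case using unmatched by (simp add: pending_def)
next
  case (match D st xs D' t j a i)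
  have "i \<notin> D'" "j \<notin> D'"
    using scan_run_marks_subset[OF match.hyps] match.prems
    by (auto simp: pending_def image_iff)
  moreover have "unmarked D' (pending st xs) \<in> Dyck T"
    by (rule match.IH) (use match.prems in \<open>auto simp: pending_def\<close>)
  moreover have "[Op a, Cl a] \<in> Dyck T"
    using Dyck.wrap[OF _ Dyck.empty, of a T] match.prems(3)
    by (auto simp: pending_def alphabet_def)
  ultimately show ?case using Dyck_insert by (fastforce simp: pending_def)
next
  case (pop a b j D st i xs D' t)
  have "j \<in> D'" using scan_run_marks_increase[OF pop.hyps(2)] by auto
  moreover have "unmarked D' (pending st ((i, Cl b) # xs)) \<in> Dyck T"
    by (rule pop.IH) (use pop.prems in \<open>auto simp: pending_def\<close>)
  ultimately show ?case by (simp add: pending_def)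
next
  case (skip a b i D j st xs D' t)
  have "i \<in> D'" using scan_run_marks_increase[OF skip.hyps(2)] by auto
  moreover have "unmarked D' (pending ((j, a) # st) xs) \<in> Dyck T"
    by (rule skip.IH) (use skip.prems in \<open>auto simp: pending_def\<close>)
  ultimately show ?case by (simp add: pending_def split: if_splits)
qed

lemma edit_dist_unmarked_le:
  assumes "finite D" and "distinct (map fst xs)"
  shows "edit_dist (map snd xs) (unmarked D xs) \<le> card D"
proof -
  let ?marked = "filter (\<lambda>x. fst x \<in> D) xs"
  have "edit_dist (map snd xs) (unmarked D xs) \<le> length ?marked"
    using edit_dist_map_filter[of snd xs "\<lambda>x. fst x \<notin> D"] by (simp add: unmarked_def)
  also have "\<dots> = card (fst ` set ?marked)"
    using distinct_card[of "map fst ?marked"] assms(2) by (simp add: distinct_map_filter)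
  also have "\<dots> \<le> card D"
    by (rule card_mono) (use assms(1) in auto)
  finally show ?thesis .
qed

section \<open>Number of deletions\<close>

definition scan_marks ::
  "nat set \<Rightarrow> (nat \<times> 'a) list \<Rightarrow> (nat \<times> 'a paren) list \<Rightarrow> nat set pmf" where
  "scan_marks D st xs = map_pmf fst (scan D st xs)"

lemma map_pmf_fst_charge [simp]: "map_pmf fst (charge c p) = map_pmf fst p"
  by (simp add: charge_def pmf.map_comp comp_def case_prod_unfold)

lemma scan_marks_simps [simp]:
  "scan_marks D st [] = return_pmf (D \<union> fst ` set st)"
  "scan_marks D st ((i, Op a) # xs) = scan_marks D ((i, a) # st) xs"
  "scan_marks D [] ((i, Cl b) # xs) = scan_marks (insert i D) [] xs"
  "scan_marks D ((j, a) # st) ((i, Cl b) # xs) =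
    (if a = b then scan_marks D st xs
     else do {
       coin \<leftarrow> bernoulli_pmf (1/2);
       if coin then scan_marks (insert j D) st ((i, Cl b) # xs)
       else scan_marks (insert i D) ((j, a) # st) xs
     })"
  by (auto simp: scan_marks_def clear_stack_eq map_bind_pmf intro!: bind_pmf_cong)

definition prob_marks_within ::
  "nat \<Rightarrow> nat set \<Rightarrow> (nat \<times> 'a) list \<Rightarrow> (nat \<times> 'a paren) list \<Rightarrow> real" where
  "prob_marks_within m D st xs =
    measure_pmf.prob (scan_marks D st xs) {D'. card D' \<le> card D + m}"

lemma prob_marks_within_insert:
  "prob_marks_within m (insert i D) st xs
    \<le> measure_pmf.prob (scan_marks (insert i D) st xs) {D'. card D' \<le> card D + Suc m}"
proof -
  have "card (insert i D) \<le> Suc (card D)" by (rule card_insert_le_m1) auto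
  then show ?thesis
    unfolding prob_marks_within_def by (intro measure_pmf.finite_measure_mono) auto
qed

lemma prob_marks_within_Nil:
  assumes "length st \<le> m"
  shows "prob_marks_within m D st [] = 1"
proof -
  have "card (D \<union> fst ` set st) \<le> card D + card (fst ` set st)"
    by (rule card_Un_le)
  also have "card (fst ` set st) \<le> length st"
    using card_length[of "map fst st"] by simp
  finally show ?thesis using assms by (simp add: prob_marks_within_def indicator_def)
qed

lemma prob_marks_within_unmatched:
  "prob_marks_within m (insert i D) [] xs \<le> prob_marks_within (Suc m) D [] ((i, Cl b) # xs)"
  using prob_marks_within_insert[of m i D "[]" xs]
  by (simp add: prob_marks_within_def[of "Suc m"])

lemma prob_marks_within_mismatch:
  assumes "a \<noteq> b"
  shows "(prob_marks_within m (insert j D) st ((i, Cl b) # xs)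
      + prob_marks_within m (insert i D) ((j, a) # st) xs) / 2
    \<le> prob_marks_within (Suc m) D ((j, a) # st) ((i, Cl b) # xs)"
  using assms prob_marks_within_insert[of m j D st "(i, Cl b) # xs"]
    prob_marks_within_insert[of m i D "(j, a) # st" xs]
  by (simp add: prob_marks_within_def[of "Suc m"] prob_bind_pmf)

lemma hit_prob_le_prob_marks_within:
  "hit_prob (del_dist (map snd st) (map snd xs)) m \<le> prob_marks_within m D st xs"
proof (induction D st xs arbitrary: m rule: scan.induct)
  case (1 D st)
  show ?case
    using hit_prob_le_1 prob_marks_within_Nil[of st m D] hit_prob_eq_0[of m "length st"]
    by (cases "length st \<le> m") (auto simp: prob_marks_within_def)
next
  case (2 D st i a xs)
  then show ?case by (simp add: prob_marks_within_def)
next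
  case (3 D i b xs)
  show ?case
  proof (cases m)
    case (Suc m')
    let ?k = "del_dist [] (map snd xs)"
    have "hit_prob (Suc ?k) (Suc m') \<le> hit_prob ?k m'" by (rule hit_prob_Suc_Suc_le)
    also have "\<dots> \<le> prob_marks_within m' (insert i D) [] xs" using 3[of m'] by simp
    also note prob_marks_within_unmatched
    finally show ?thesis using Suc by simp
  qed (simp add: prob_marks_within_def)
next
  case (4 D j a st i b xs)
  show ?case
  proof (cases "a = b")
    case True
    then show ?thesis using 4(1) by (simp add: prob_marks_within_def)
  next
    case mismatch: False
    show ?thesis
    proof (cases m)
      case (Suc m')
      let ?pop = "del_dist (map snd st) (map snd ((i, Cl b) # xs))"
      let ?skip = "del_dist (map snd ((j, a) # st)) (map snd xs)"
      have "hit_prob (Suc (min ?pop ?skip)) (Suc m') \<le> (hit_prob ?pop m' + hit_prob ?skip m') / 2"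
        using del_dist_mismatch_near by (intro hit_prob_Suc_min_le) simp
      also have "\<dots> \<le> (prob_marks_within m' (insert j D) st ((i, Cl b) # xs)
          + prob_marks_within m' (insert i D) ((j, a) # st) xs) / 2"
        using 4(2)[OF mismatch, of True m'] 4(3)[OF mismatch, of False m'] by simp
      also note prob_marks_within_mismatch[OF mismatch]
      finally show ?thesis using mismatch Suc by simp
    qed (use mismatch in \<open>simp add: prob_marks_within_def\<close>)
  qed
qed

section \<open>Random-deletion\<close>

lemma fst_emit: "fst (emit D xs) = unmarked D xs"
  by (induction D xs rule: emit.induct) (auto simp: case_prod_unfold Let_def)

lemma snd_emit_le: "snd (emit D xs) \<le> 5 * length xs + 1"
  by (induction D xs rule: emit.induct) (auto simp: case_prod_unfold Let_def)

lemma random_deletion_eq_map_scan: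
  "random_deletion \<sigma> =
    map_pmf (\<lambda>(D, t). (unmarked D (List.enumerate 0 \<sigma>),
        length \<sigma> + 1 + t + snd (emit D (List.enumerate 0 \<sigma>))))
      (scan {} [] (List.enumerate 0 \<sigma>))"
  unfolding random_deletion_def charge_def
  by (simp add: map_pmf_def bind_return_pmf bind_assoc_pmf case_prod_unfold fst_emit add.assoc)

lemma random_deletion_run:
  assumes "(w, t) \<in> set_pmf (random_deletion \<sigma>)"
  obtains D t' where "scan_run {} [] (List.enumerate 0 \<sigma>) D t'"
    and "w = unmarked D (List.enumerate 0 \<sigma>)"
    and "t = length \<sigma> + 1 + t' + snd (emit D (List.enumerate 0 \<sigma>))"
  using assms by (auto simp: random_deletion_eq_map_scan dest!: scan_run_if_in_set_pmf)

lemma random_deletion_time: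
  assumes "(w, t) \<in> set_pmf (random_deletion \<sigma>)"
  shows "t \<le> 20 * (length \<sigma> + 1)"
proof -
  obtain D t' where run: "scan_run {} [] (List.enumerate 0 \<sigma>) D t'"
    and t: "t = length \<sigma> + 1 + t' + snd (emit D (List.enumerate 0 \<sigma>))"
    using assms by (rule random_deletion_run)
  show ?thesis
    using scan_run_time[OF run] snd_emit_le[of D "List.enumerate 0 \<sigma>"] t by simp
qed

lemma random_deletion_in_Dyck:
  assumes "\<sigma> \<in> lists (alphabet T)" and "(w, t) \<in> set_pmf (random_deletion \<sigma>)"
  shows "w \<in> Dyck T"
proof -
  obtain D t' where run: "scan_run {} [] (List.enumerate 0 \<sigma>) D t'"
    and w: "w = unmarked D (List.enumerate 0 \<sigma>)"
    using assms(2) by (rule random_deletion_run)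
  have "snd ` set (List.enumerate 0 \<sigma>) \<subseteq> alphabet T"
    using assms(1) by (metis in_listsD list.set_map map_snd_enumerate subsetI)
  then show ?thesis
    using unmarked_pending_in_Dyck[OF run] w by (simp add: pending_def)
qed

lemma hit_prob_le_prob_random_deletion:
  "hit_prob (del_dist [] \<sigma>) m
    \<le> measure_pmf.prob (random_deletion \<sigma>) {(w, t). edit_dist \<sigma> w \<le> m}"
proof -
  let ?xs = "List.enumerate 0 \<sigma>"
  have "edit_dist \<sigma> (unmarked D ?xs) \<le> m"
    if D: "D \<in> set_pmf (scan_marks {} [] ?xs)" and card_D: "card D \<le> m" for D
  proof -
    obtain t where "(D, t) \<in> set_pmf (scan {} [] ?xs)"
      using D by (auto simp: scan_marks_def)
    then have "finite D"
      using scan_run_if_in_set_pmf scan_run_finite_marks by blast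
    then show ?thesis
      using edit_dist_unmarked_le[of D ?xs] card_D by simp
  qed
  then have "prob_marks_within m {} [] ?xs
      \<le> measure_pmf.prob (scan_marks {} [] ?xs) {D. edit_dist \<sigma> (unmarked D ?xs) \<le> m}"
    unfolding prob_marks_within_def
    by (intro measure_pmf.finite_measure_mono_AE) (auto simp: AE_measure_pmf_iff)
  also have "\<dots> = measure_pmf.prob (random_deletion \<sigma>) {(w, t). edit_dist \<sigma> w \<le> m}"
    by (simp add: random_deletion_eq_map_scan scan_marks_def vimage_def case_prod_unfold)
  finally show ?thesis
    using hit_prob_le_prob_marks_within[of "[]" ?xs m "{}"] by simp
qed

lemma prob_random_deletion_Dyck:
  assumes "\<sigma> \<in> lists (alphabet T)"
  shows "measure_pmf.prob (random_deletion \<sigma>) {(w, t). w \<in> Dyck T \<and> Q w}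
    = measure_pmf.prob (random_deletion \<sigma>) {(w, t). Q w}"
  by (rule measure_pmf.finite_measure_eq_AE)
    (use random_deletion_in_Dyck[OF assms] in \<open>auto simp: AE_measure_pmf_iff\<close>)

theorem theorem1:
  "\<exists>(p::real) > 0. \<exists>C::nat. \<forall>(s::nat) (T :: 'a set) (n::nat) (\<sigma> :: 'a paren list) (d::nat).
     s \<ge> 2 \<longrightarrow> finite T \<longrightarrow> card T = s \<longrightarrow>
     \<sigma> \<in> lists (alphabet T) \<longrightarrow> length \<sigma> = n \<longrightarrow>
     d = edit_dist_lang \<sigma> (Dyck T) \<longrightarrow>
       (\<forall>(w, t) \<in> set_pmf (random_deletion \<sigma>). t \<le> C * (n + 1)) \<and>
       measure_pmf.prob (random_deletion \<sigma>)
         {(w, t). w \<in> Dyck T \<and> edit_dist \<sigma> w \<le> (4 * d) * d} \<ge> p"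
proof (intro exI conjI allI impI)
  show "(1 / 6 :: real) ^ 12 > 0" by simp
next
  fix s n d :: nat and T :: "'a set" and \<sigma> :: "'a paren list"
  assume \<sigma>: "\<sigma> \<in> lists (alphabet T)" and n: "length \<sigma> = n"
    and d: "d = edit_dist_lang \<sigma> (Dyck T)"
  show "\<forall>(w, t) \<in> set_pmf (random_deletion \<sigma>). t \<le> 20 * (n + 1)"
    using random_deletion_time n by blast
  have "(1 / 6) ^ 12 \<le> hit_prob (2 * d) ((2 * d)\<^sup>2)" by (rule hit_prob_square_ge)
  also have "\<dots> \<le> hit_prob (del_dist [] \<sigma>) ((2 * d)\<^sup>2)"
    unfolding d by (intro hit_prob_antimono_start del_dist_le_edit_dist_lang)
  also have "(2 * d)\<^sup>2 = (4 * d) * d" by (simp add: power2_eq_square)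
  also note hit_prob_le_prob_random_deletion
  also note prob_random_deletion_Dyck[OF \<sigma>, symmetric]
  finally show "(1 / 6) ^ 12 \<le> measure_pmf.prob (random_deletion \<sigma>)
      {(w, t). w \<in> Dyck T \<and> edit_dist \<sigma> w \<le> (4 * d) * d}" .
qed

end
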